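(* Let $\mathcal{C}$ be a triangulated category. Assume that both $\mathcal{X}$ and $\mathcal{Y}$ are covariantly finite subcategories in $\mathcal{C}$. Then the extension subcategory $\mathcal{X}\ast\mathcal{Y}$ is covariantly finite in $\mathcal{C}$.
   Context: By a subcategory of an additive category $\mathcal{C}$ we always mean a full additive subcategory. Let $\mathcal{X}$ be a subcategory of $\mathcal{C}$ and $M\in\mathcal{C}$. A morphism $x_M: M\to X_M$ is called a left $\mathcal{X}$-approximation of $M$ if $X_M\in\mathcal{X}$ and every morphism from $M$ to an object in $\mathcal{X}$ factors through $x_M$ (the factorization need not be unique). The subcategory $\mathcal{X}$ is covariantly finite in $\mathcal{C}$ if every object of $\mathcal{C}$ has a left $\mathcal{X}$-approximation. For a triangulated category $\mathcal{C}$ with translation functor $[1]$ and subcategories $\mathcal{X},\mathcal{Y}$, the extension subcategory $\mathcal{X}\ast\mathcal{Y}$ is the (full) subcategory consisting of the objects $Z$ such that there is a distinguished triangle $X\to Z\to Y\to X[1]$ with $X\in\mathcal{X}$ and $Y\in\mathcal{Y}$. *)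

theory Defs
  imports "HOL-Algebra.Group"
begin

section \<open>Categories\<close>

text \<open>Composition is written in the usual order: \<open>g \<cdot> f\<close> is \<open>f\<close> followed by \<open>g\<close>. The
  operations are unspecified outside the objects, respectively the composable or parallel
  morphisms, of the category.\<close>

record ('o, 'm) category =
  Obj :: "'o set"
  Mor :: "'m set"
  Dom :: "'m \<Rightarrow> 'o"
  Cod :: "'m \<Rightarrow> 'o"
  Id :: "'o \<Rightarrow> 'm"
  Comp :: "'m \<Rightarrow> 'm \<Rightarrow> 'm"  (infixl \<open>\<cdot>\<index>\<close> 70)

definition Hom :: "('o, 'm, 'z) category_scheme \<Rightarrow> 'o \<Rightarrow> 'o \<Rightarrow> 'm set" where
  "Hom C A B = {f \<in> Mor C. Dom C f = A \<and> Cod C f = B}"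

locale category =
  fixes C :: "('o, 'm, 'z) category_scheme" (structure)
  assumes dom_obj: "f \<in> Mor C \<Longrightarrow> Dom C f \<in> Obj C"
    and cod_obj: "f \<in> Mor C \<Longrightarrow> Cod C f \<in> Obj C"
    and id_hom: "A \<in> Obj C \<Longrightarrow> Id C A \<in> Hom C A A"
    and comp_hom: "f \<in> Hom C A B \<Longrightarrow> g \<in> Hom C B D \<Longrightarrow> g \<cdot> f \<in> Hom C A D"
    and comp_id_right: "f \<in> Hom C A B \<Longrightarrow> f \<cdot> Id C A = f"
    and comp_id_left: "f \<in> Hom C A B \<Longrightarrow> Id C B \<cdot> f = f"
    and comp_assoc: "f \<in> Hom C A B \<Longrightarrow> g \<in> Hom C B D \<Longrightarrow> h \<in> Hom C D E
      \<Longrightarrow> h \<cdot> (g \<cdot> f) = (h \<cdot> g) \<cdot> f"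

definition isomorphism :: "('o, 'm, 'z) category_scheme \<Rightarrow> 'o \<Rightarrow> 'o \<Rightarrow> 'm \<Rightarrow> bool" where
  "isomorphism C A B f \<longleftrightarrow> f \<in> Hom C A B \<and>
    (\<exists>g \<in> Hom C B A. g \<cdot>\<^bsub>C\<^esub> f = Id C A \<and> f \<cdot>\<^bsub>C\<^esub> g = Id C B)"

definition zero_object :: "('o, 'm, 'z) category_scheme \<Rightarrow> 'o \<Rightarrow> bool" where
  "zero_object C Z \<longleftrightarrow> Z \<in> Obj C \<and>
    (\<forall>A \<in> Obj C. (\<exists>!f. f \<in> Hom C Z A) \<and> (\<exists>!f. f \<in> Hom C A Z))"

section \<open>Additive categories\<close>

record ('o, 'm) additive_category = "('o, 'm) category" +
  Add :: "'m \<Rightarrow> 'm \<Rightarrow> 'm"  (infixl \<open>\<oplus>\<index>\<close> 65)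
  ZeroM :: "'o \<Rightarrow> 'o \<Rightarrow> 'm"

definition hom_group :: "('o, 'm, 'z) additive_category_scheme \<Rightarrow> 'o \<Rightarrow> 'o \<Rightarrow> 'm monoid" where
  "hom_group C A B = \<lparr>carrier = Hom C A B, mult = Add C, one = ZeroM C A B\<rparr>"

definition Neg :: "('o, 'm, 'z) additive_category_scheme \<Rightarrow> 'm \<Rightarrow> 'm" where
  "Neg C f = inv\<^bsub>hom_group C (Dom C f) (Cod C f)\<^esub> f"

definition biproduct ::
  "('o, 'm, 'z) additive_category_scheme \<Rightarrow> 'o \<Rightarrow> 'o \<Rightarrow> 'o \<Rightarrow> 'm \<Rightarrow> 'm \<Rightarrow> 'm \<Rightarrow> 'm \<Rightarrow> bool" where
  "biproduct C A B S i j p q \<longleftrightarrow>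
    i \<in> Hom C A S \<and> j \<in> Hom C B S \<and> p \<in> Hom C S A \<and> q \<in> Hom C S B \<and>
    p \<cdot>\<^bsub>C\<^esub> i = Id C A \<and> q \<cdot>\<^bsub>C\<^esub> j = Id C B \<and>
    p \<cdot>\<^bsub>C\<^esub> j = ZeroM C B A \<and> q \<cdot>\<^bsub>C\<^esub> i = ZeroM C A B \<and>
    (i \<cdot>\<^bsub>C\<^esub> p) \<oplus>\<^bsub>C\<^esub> (j \<cdot>\<^bsub>C\<^esub> q) = Id C S"

locale additive_category = category C
  for C :: "('o, 'm, 'z) additive_category_scheme" (structure) +
  assumes hom_comm_group: "A \<in> Obj C \<Longrightarrow> B \<in> Obj C \<Longrightarrow> comm_group (hom_group C A B)"
    and comp_add_right: "f \<in> Hom C A B \<Longrightarrow> f' \<in> Hom C A B \<Longrightarrow> g \<in> Hom C B D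
      \<Longrightarrow> g \<cdot> (f \<oplus> f') = (g \<cdot> f) \<oplus> (g \<cdot> f')"
    and comp_add_left: "f \<in> Hom C A B \<Longrightarrow> g \<in> Hom C B D \<Longrightarrow> g' \<in> Hom C B D
      \<Longrightarrow> (g \<oplus> g') \<cdot> f = (g \<cdot> f) \<oplus> (g' \<cdot> f)"
    and ex_zero_object: "\<exists>Z. zero_object C Z"
    and ex_biproduct: "A \<in> Obj C \<Longrightarrow> B \<in> Obj C \<Longrightarrow> \<exists>S \<in> Obj C. \<exists>i j p q. biproduct C A B S i j p q"

section \<open>Subcategories and approximations\<close>

text \<open>A full subcategory is given by its set of objects, which is not required to be closed
  under isomorphisms.\<close>

definition full_subcategory ::
  "('o, 'm, 'z) category_scheme \<Rightarrow> 'o set \<Rightarrow> ('o, 'm, 'z) category_scheme" where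
  "full_subcategory C X =
    C\<lparr>Obj := X, Mor := {f \<in> Mor C. Dom C f \<in> X \<and> Cod C f \<in> X}\<rparr>"

definition full_additive_subcategory ::
  "('o, 'm, 'z) additive_category_scheme \<Rightarrow> 'o set \<Rightarrow> bool" where
  "full_additive_subcategory C X \<longleftrightarrow> X \<subseteq> Obj C \<and> additive_category (full_subcategory C X)"

definition left_approximation ::
  "('o, 'm, 'z) category_scheme \<Rightarrow> 'o set \<Rightarrow> 'o \<Rightarrow> 'o \<Rightarrow> 'm \<Rightarrow> bool" where
  "left_approximation C X M A x \<longleftrightarrow> A \<in> X \<and> x \<in> Hom C M A \<and>
    (\<forall>B \<in> X. \<forall>f \<in> Hom C M B. \<exists>g \<in> Hom C A B. f = g \<cdot>\<^bsub>C\<^esub> x)"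

definition covariantly_finite ::
  "('o, 'm, 'z) additive_category_scheme \<Rightarrow> 'o set \<Rightarrow> bool" where
  "covariantly_finite C X \<longleftrightarrow> full_additive_subcategory C X \<and>
    (\<forall>M \<in> Obj C. \<exists>A x. left_approximation C X M A x)"

section \<open>Triangulated categories\<close>

text \<open>A triangle \<open>A \<rightarrow> B \<rightarrow> D \<rightarrow> A[1]\<close> is represented by its three morphisms; \<open>Tri\<close> is the
  collection of distinguished triangles, and \<open>ShO\<close>, \<open>ShM\<close> are the actions of the translation
  functor on objects and morphisms.\<close>

record ('o, 'm) triangulated_category = "('o, 'm) additive_category" +
  ShO :: "'o \<Rightarrow> 'o"
  ShM :: "'m \<Rightarrow> 'm"
  Tri :: "('m \<times> 'm \<times> 'm) set"

definition triangle ::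
  "('o, 'm, 'z) triangulated_category_scheme \<Rightarrow> 'o \<Rightarrow> 'o \<Rightarrow> 'o \<Rightarrow> 'm \<Rightarrow> 'm \<Rightarrow> 'm \<Rightarrow> bool" where
  "triangle C A B D f g h \<longleftrightarrow> f \<in> Hom C A B \<and> g \<in> Hom C B D \<and> h \<in> Hom C D (ShO C A)"

definition distinguished ::
  "('o, 'm, 'z) triangulated_category_scheme \<Rightarrow> 'o \<Rightarrow> 'o \<Rightarrow> 'o \<Rightarrow> 'm \<Rightarrow> 'm \<Rightarrow> 'm \<Rightarrow> bool" where
  "distinguished C A B D f g h \<longleftrightarrow> triangle C A B D f g h \<and> (f, g, h) \<in> Tri C"

text \<open>The translation functor is an additive autoequivalence (fully faithful and essentially
  surjective); this includes the convention that it is an automorphism.\<close>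

locale triangulated_category = additive_category C
  for C :: "('o, 'm, 'z) triangulated_category_scheme" (structure) +
  assumes shift_obj: "A \<in> Obj C \<Longrightarrow> ShO C A \<in> Obj C"
    and shift_id: "A \<in> Obj C \<Longrightarrow> ShM C (Id C A) = Id C (ShO C A)"
    and shift_comp: "f \<in> Hom C A B \<Longrightarrow> g \<in> Hom C B D \<Longrightarrow> ShM C (g \<cdot> f) = ShM C g \<cdot> ShM C f"
    and shift_add: "f \<in> Hom C A B \<Longrightarrow> g \<in> Hom C A B \<Longrightarrow> ShM C (f \<oplus> g) = ShM C f \<oplus> ShM C g"
    and shift_fully_faithful:
      "A \<in> Obj C \<Longrightarrow> B \<in> Obj C \<Longrightarrow> bij_betw (ShM C) (Hom C A B) (Hom C (ShO C A) (ShO C B))"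
    and shift_ess_surj: "B \<in> Obj C \<Longrightarrow> \<exists>A \<in> Obj C. \<exists>f. isomorphism C (ShO C A) B f"
    and TR1_iso: "distinguished C A B D f g h \<Longrightarrow> triangle C A' B' D' f' g' h'
      \<Longrightarrow> isomorphism C A A' a \<Longrightarrow> isomorphism C B B' b \<Longrightarrow> isomorphism C D D' d
      \<Longrightarrow> b \<cdot> f = f' \<cdot> a \<Longrightarrow> d \<cdot> g = g' \<cdot> b \<Longrightarrow> ShM C a \<cdot> h = h' \<cdot> d
      \<Longrightarrow> distinguished C A' B' D' f' g' h'"
    and TR1_id: "A \<in> Obj C \<Longrightarrow> zero_object C Z
      \<Longrightarrow> distinguished C A A Z (Id C A) (ZeroM C A Z) (ZeroM C Z (ShO C A))"
    and TR1_cone: "f \<in> Hom C A B \<Longrightarrow> \<exists>D g h. distinguished C A B D f g h"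
    and TR2: "triangle C A B D f g h
      \<Longrightarrow> distinguished C A B D f g h \<longleftrightarrow> distinguished C B D (ShO C A) g h (Neg C (ShM C f))"
    and TR3: "distinguished C A B D f g h \<Longrightarrow> distinguished C A' B' D' f' g' h'
      \<Longrightarrow> a \<in> Hom C A A' \<Longrightarrow> b \<in> Hom C B B' \<Longrightarrow> b \<cdot> f = f' \<cdot> a
      \<Longrightarrow> \<exists>d \<in> Hom C D D'. d \<cdot> g = g' \<cdot> b \<and> ShM C a \<cdot> h = h' \<cdot> d"
    and TR4: "distinguished C A B D' f i i' \<Longrightarrow> distinguished C B D A' g j j'
      \<Longrightarrow> distinguished C A D B' (g \<cdot> f) k k'
      \<Longrightarrow> \<exists>u v. distinguished C D' B' A' u v (ShM C i \<cdot> j') \<and>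
            u \<cdot> i = k \<cdot> g \<and> k' \<cdot> u = i' \<and> v \<cdot> k = j \<and> j' \<cdot> v = ShM C f \<cdot> k'"

definition extension ::
  "('o, 'm, 'z) triangulated_category_scheme \<Rightarrow> 'o set \<Rightarrow> 'o set \<Rightarrow> 'o set" where
  "extension C X Y = {Z \<in> Obj C. \<exists>A \<in> X. \<exists>B \<in> Y. \<exists>f g h. distinguished C A Z B f g h}"

end

theory Submission
  imports Defs
begin

text \<open>Let \<open>y : M \<rightarrow> V\<close> be a left \<open>Y\<close>-approximation, complete it to a triangle
  \<open>K \<rightarrow> M \<rightarrow> V \<rightarrow> K[1]\<close> with last morphism \<open>h\<close>, and let \<open>x : K \<rightarrow> U\<close> be a left
  \<open>X\<close>-approximation. In a triangle \<open>U \<rightarrow> Z \<rightarrow> V \<rightarrow> U[1]\<close> with last morphism \<open>x[1] h\<close>, any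
  filler \<open>m : M \<rightarrow> Z\<close> of \<open>(x, id)\<close> is the required approximation: a morphism \<open>M \<rightarrow> W\<close> with
  \<open>U' \<rightarrow> W \<rightarrow> V'\<close> extends to a morphism of triangles because \<open>M \<rightarrow> W \<rightarrow> V'\<close> factors through \<open>y\<close>;
  its component \<open>K \<rightarrow> U'\<close> factors through \<open>x\<close>, and \<open>Z\<close> has the weak pushout property for
  \<open>K \<rightarrow> M\<close> and \<open>K \<rightarrow> U\<close>.

  Closure under biproducts amounts to a direct sum of distinguished triangles being
  distinguished. A distinguished triangle on the sum of the outer terms maps to the direct sum
  and back; both round trips are the identity on the ends, hence of the form \<open>1 + n\<close> with
  \<open>n\<^sup>2 = 0\<close>, and so the comparison map is an isomorphism.\<close>

section \<open>Typed calculus of morphisms\<close>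

context category
begin

lemma Hom_iff: "f \<in> Hom C A B \<longleftrightarrow> f \<in> Mor C \<and> Dom C f = A \<and> Cod C f = B"
  by (simp add: Hom_def)

text \<open>Typing is expressed through \<open>Mor\<close>, \<open>Dom\<close> and
  \<open>Cod\<close> instead of \<open>Hom\<close>, so that the simplifier computes domains and
  codomains and has no intermediate object to guess.\<close>

lemma comp_mor [simp]:
  assumes "f \<in> Mor C" "g \<in> Mor C" "Dom C g = Cod C f"
  shows "g \<cdot> f \<in> Mor C" "Dom C (g \<cdot> f) = Dom C f" "Cod C (g \<cdot> f) = Cod C g"
  using comp_hom[of f "Dom C f" "Cod C f" g "Cod C g"] assms by (simp_all add: Hom_iff)

lemma id_mor [simp]:
  assumes "A \<in> Obj C"
  shows "Id C A \<in> Mor C" "Dom C (Id C A) = A" "Cod C (Id C A) = A"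
  using id_hom[OF assms] by (simp_all add: Hom_iff)

lemma comp_id [simp]:
  "f \<in> Mor C \<Longrightarrow> Dom C f = A \<Longrightarrow> f \<cdot> Id C A = f"
  "f \<in> Mor C \<Longrightarrow> Cod C f = B \<Longrightarrow> Id C B \<cdot> f = f"
  using comp_id_right comp_id_left by (auto simp: Hom_iff)

lemma comp_assoc_mor:
  assumes "f \<in> Mor C" "g \<in> Mor C" "h \<in> Mor C" "Dom C g = Cod C f" "Dom C h = Cod C g"
  shows "(h \<cdot> g) \<cdot> f = h \<cdot> (g \<cdot> f)"
  using comp_assoc[of f "Dom C f" "Cod C f" g "Cod C g" h "Cod C h"] assms
  by (simp add: Hom_iff)

text \<open>Composites are normalised to the right, which hides \<open>g \<cdot> f\<close> inside
  \<open>g \<cdot> (f \<cdot> x)\<close>; in this form an equation for \<open>g \<cdot> f\<close>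
  can act there as well.\<close>

lemma comp_reduce:
  assumes "g \<cdot> f = r" "f \<in> Hom C A B" "g \<in> Hom C B D" "x \<in> Mor C" "Cod C x = A"
  shows "g \<cdot> (f \<cdot> x) = r \<cdot> x"
  using assms comp_assoc_mor[of x f g] by (simp add: Hom_iff)

section \<open>Isomorphisms\<close>

lemma isomorphism_sym:
  "isomorphism C A B f \<Longrightarrow> \<exists>g. isomorphism C B A g \<and> g \<cdot> f = Id C A \<and> f \<cdot> g = Id C B"
  unfolding isomorphism_def by blast

lemma Hom_obj: "f \<in> Hom C A B \<Longrightarrow> A \<in> Obj C \<and> B \<in> Obj C"
  using dom_obj cod_obj by (auto simp: Hom_iff)

lemma isomorphism_id: "A \<in> Obj C \<Longrightarrow> isomorphism C A A (Id C A)"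
  unfolding isomorphism_def by (auto simp: Hom_iff intro!: bexI[of _ "Id C A"])

text \<open>The left inverse \<open>a \<cdot> l\<close> and the right inverse
  \<open>r \<cdot> b\<close> of \<open>f\<close> coincide by associativity.\<close>

lemma isomorphism_of_inverses:
  assumes f: "f \<in> Hom C A B" and l: "l \<in> Hom C B A" "isomorphism C A A (l \<cdot> f)"
    and r: "r \<in> Hom C B A" "isomorphism C B B (f \<cdot> r)"
  shows "isomorphism C A B f"
proof -
  obtain a where a: "a \<in> Hom C A A" "a \<cdot> (l \<cdot> f) = Id C A"
    using l(2) by (auto simp: isomorphism_def)
  obtain b where b: "b \<in> Hom C B B" "(f \<cdot> r) \<cdot> b = Id C B"
    using r(2) by (auto simp: isomorphism_def)
  have "(a \<cdot> l) \<cdot> (f \<cdot> (r \<cdot> b)) = ((a \<cdot> l) \<cdot> f) \<cdot> (r \<cdot> b)"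
    using f l r a(1) b(1) by (simp add: Hom_iff comp_assoc_mor)
  then have "a \<cdot> l = r \<cdot> b"
    using f l r a b Hom_obj[OF f] by (simp add: Hom_iff comp_assoc_mor)
  moreover have "(a \<cdot> l) \<cdot> f = Id C A" "f \<cdot> (r \<cdot> b) = Id C B" "r \<cdot> b \<in> Hom C B A"
    using f l r a b by (auto simp: Hom_iff comp_assoc_mor)
  ultimately show ?thesis
    unfolding isomorphism_def using f by auto
qed

end

section \<open>Additive structure on morphisms\<close>

context additive_category
begin

lemma zero_mor [simp]:
  assumes "A \<in> Obj C" "B \<in> Obj C"
  shows "ZeroM C A B \<in> Mor C" "Dom C (ZeroM C A B) = A" "Cod C (ZeroM C A B) = B"
proof -
  interpret G: comm_group "hom_group C A B" using assms by (rule hom_comm_group)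
  show "ZeroM C A B \<in> Mor C" "Dom C (ZeroM C A B) = A" "Cod C (ZeroM C A B) = B"
    using G.one_closed by (simp_all add: hom_group_def Hom_iff)
qed

lemma add_hom: "f \<in> Hom C A B \<Longrightarrow> g \<in> Hom C A B \<Longrightarrow> f \<oplus> g \<in> Hom C A B"
proof -
  assume h: "f \<in> Hom C A B" "g \<in> Hom C A B"
  interpret G: comm_group "hom_group C A B" using Hom_obj[OF h(1)] by (intro hom_comm_group) auto
  show "f \<oplus> g \<in> Hom C A B" using G.m_closed h by (simp add: hom_group_def)
qed

lemma add_mor [simp]:
  assumes "f \<in> Mor C" "g \<in> Mor C" "Dom C g = Dom C f" "Cod C g = Cod C f"
  shows "f \<oplus> g \<in> Mor C" "Dom C (f \<oplus> g) = Dom C f" "Cod C (f \<oplus> g) = Cod C f"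
  using add_hom[of f "Dom C f" "Cod C f" g] assms by (simp_all add: Hom_iff)

lemma neg_mor [simp]:
  assumes "f \<in> Mor C"
  shows "Neg C f \<in> Mor C" "Dom C (Neg C f) = Dom C f" "Cod C (Neg C f) = Cod C f"
proof -
  interpret G: comm_group "hom_group C (Dom C f) (Cod C f)"
    using assms by (intro hom_comm_group dom_obj cod_obj)
  have "Neg C f \<in> Hom C (Dom C f) (Cod C f)"
    using G.inv_closed[of f] assms by (simp add: hom_group_def Neg_def Hom_iff)
  then show "Neg C f \<in> Mor C" "Dom C (Neg C f) = Dom C f" "Cod C (Neg C f) = Cod C f"
    by (simp_all add: Hom_iff)
qed

lemma add_assoc_mor:
  assumes "f \<in> Mor C" "g \<in> Mor C" "h \<in> Mor C"
    "Dom C g = Dom C f" "Cod C g = Cod C f" "Dom C h = Dom C f" "Cod C h = Cod C f"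
  shows "(f \<oplus> g) \<oplus> h = f \<oplus> (g \<oplus> h)"
proof -
  interpret G: comm_group "hom_group C (Dom C f) (Cod C f)"
    using assms by (intro hom_comm_group dom_obj cod_obj)
  show ?thesis using G.m_assoc[of f g h] assms by (simp add: hom_group_def Hom_iff)
qed

lemma add_commute_mor:
  assumes "f \<in> Mor C" "g \<in> Mor C" "Dom C g = Dom C f" "Cod C g = Cod C f"
  shows "f \<oplus> g = g \<oplus> f"
proof -
  interpret G: comm_group "hom_group C (Dom C f) (Cod C f)"
    using assms by (intro hom_comm_group dom_obj cod_obj)
  show ?thesis using G.m_comm[of f g] assms by (simp add: hom_group_def Hom_iff)
qed

lemma add_zero_right [simp]:
  assumes "f \<in> Mor C" "Dom C f = A" "Cod C f = B"
  shows "f \<oplus> ZeroM C A B = f"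
proof -
  interpret G: comm_group "hom_group C A B"
    using assms dom_obj[of f] cod_obj[of f] by (intro hom_comm_group) auto
  show ?thesis using G.r_one[of f] assms by (simp add: hom_group_def Hom_iff)
qed

lemma add_zero_left [simp]:
  assumes "f \<in> Mor C" "Dom C f = A" "Cod C f = B"
  shows "ZeroM C A B \<oplus> f = f"
  using assms dom_obj[of f] cod_obj[of f] by (subst add_commute_mor) auto

lemma add_neg [simp]:
  assumes "f \<in> Mor C"
  shows "f \<oplus> Neg C f = ZeroM C (Dom C f) (Cod C f)"
proof -
  interpret G: comm_group "hom_group C (Dom C f) (Cod C f)"
    using assms by (intro hom_comm_group dom_obj cod_obj)
  show ?thesis using G.r_inv[of f] assms by (simp add: hom_group_def Hom_iff Neg_def)
qed

lemma neg_add [simp]: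
  assumes "f \<in> Mor C"
  shows "Neg C f \<oplus> f = ZeroM C (Dom C f) (Cod C f)"
  using assms by (subst add_commute_mor) auto

lemma neg_eqI:
  assumes "f \<in> Mor C" "g \<in> Mor C" "Dom C g = Dom C f" "Cod C g = Cod C f"
    and "f \<oplus> g = ZeroM C (Dom C f) (Cod C f)"
  shows "Neg C f = g"
proof -
  have "Neg C f = Neg C f \<oplus> (f \<oplus> g)" using assms by simp
  also have "\<dots> = (Neg C f \<oplus> f) \<oplus> g" using assms(1-4) by (simp add: add_assoc_mor del: neg_add)
  also have "\<dots> = g" using assms(1-4) by simp
  finally show ?thesis .
qed

lemma neg_neg [simp]: "f \<in> Mor C \<Longrightarrow> Neg C (Neg C f) = f"
  by (rule neg_eqI) auto

lemma neg_zero [simp]: "A \<in> Obj C \<Longrightarrow> B \<in> Obj C \<Longrightarrow> Neg C (ZeroM C A B) = ZeroM C A B"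
  by (rule neg_eqI) auto

lemma add_neg_cancel_left:
  assumes "f \<in> Mor C" "g \<in> Mor C" "Dom C g = Dom C f" "Cod C g = Cod C f"
  shows "f \<oplus> (Neg C f \<oplus> g) = g" "Neg C f \<oplus> (f \<oplus> g) = g"
  using assms by (simp_all flip: add_assoc_mor)

text \<open>Cancellation in the hom group. It serves to show that composing with a zero morphism, or
  translating one, gives zero: by additivity the result is its own double.\<close>

lemma zero_if_idempotent:
  assumes "f \<in> Mor C" "f \<oplus> f = f"
  shows "f = ZeroM C (Dom C f) (Cod C f)"
proof -
  have "f = (f \<oplus> f) \<oplus> Neg C f" using assms(1) by (simp add: add_assoc_mor)
  then show ?thesis using assms by simp
qed

lemma comp_add_right_mor:
  assumes "f \<in> Mor C" "f' \<in> Mor C" "Dom C f' = Dom C f" "Cod C f' = Cod C f"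
    "g \<in> Mor C" "Dom C g = Cod C f"
  shows "g \<cdot> (f \<oplus> f') = (g \<cdot> f) \<oplus> (g \<cdot> f')"
  using comp_add_right[of f "Dom C f" "Cod C f" f' g "Cod C g"] assms by (simp add: Hom_iff)

lemma comp_add_left_mor:
  assumes "f \<in> Mor C" "g \<in> Mor C" "g' \<in> Mor C" "Dom C g' = Dom C g" "Cod C g' = Cod C g"
    "Dom C g = Cod C f"
  shows "(g \<oplus> g') \<cdot> f = (g \<cdot> f) \<oplus> (g' \<cdot> f)"
  using comp_add_left[of f "Dom C f" "Cod C f" g "Cod C g" g'] assms by (simp add: Hom_iff)

lemmas comp_add_mor = comp_add_right_mor comp_add_left_mor

lemma comp_zero [simp]:
  assumes "f \<in> Mor C" "A \<in> Obj C"
  shows "Dom C f = B \<Longrightarrow> f \<cdot> ZeroM C A B = ZeroM C A (Cod C f)"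
    "Cod C f = B \<Longrightarrow> ZeroM C B A \<cdot> f = ZeroM C (Dom C f) A"
proof -
  assume [simp]: "Dom C f = B"
  have B: "B \<in> Obj C" using dom_obj[OF assms(1)] by simp
  have "f \<cdot> (ZeroM C A B \<oplus> ZeroM C A B) = f \<cdot> ZeroM C A B" using assms B by simp
  then have "f \<cdot> ZeroM C A B \<oplus> f \<cdot> ZeroM C A B = f \<cdot> ZeroM C A B"
    using assms B by (simp add: comp_add_mor del: add_zero_right add_zero_left)
  from zero_if_idempotent[OF _ this] show "f \<cdot> ZeroM C A B = ZeroM C A (Cod C f)"
    using assms B by simp
next
  assume [simp]: "Cod C f = B"
  have B: "B \<in> Obj C" using cod_obj[OF assms(1)] by simp
  have "(ZeroM C B A \<oplus> ZeroM C B A) \<cdot> f = ZeroM C B A \<cdot> f" using assms B by simp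
  then have "ZeroM C B A \<cdot> f \<oplus> ZeroM C B A \<cdot> f = ZeroM C B A \<cdot> f"
    using assms B by (simp add: comp_add_mor del: add_zero_right add_zero_left)
  from zero_if_idempotent[OF _ this] show "ZeroM C B A \<cdot> f = ZeroM C (Dom C f) A"
    using assms B by simp
qed

lemma comp_neg:
  assumes "f \<in> Mor C" "g \<in> Mor C" "Dom C g = Cod C f"
  shows "g \<cdot> Neg C f = Neg C (g \<cdot> f)" "Neg C g \<cdot> f = Neg C (g \<cdot> f)"
proof -
  have "(g \<cdot> f) \<oplus> (g \<cdot> Neg C f) = g \<cdot> (f \<oplus> Neg C f)"
    using assms by (simp add: comp_add_mor del: add_neg)
  then show "g \<cdot> Neg C f = Neg C (g \<cdot> f)"
    using assms dom_obj[of f] by (intro neg_eqI[symmetric]) auto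
  have "(g \<cdot> f) \<oplus> (Neg C g \<cdot> f) = (g \<oplus> Neg C g) \<cdot> f"
    using assms by (simp add: comp_add_mor del: add_neg)
  then show "Neg C g \<cdot> f = Neg C (g \<cdot> f)"
    using assms cod_obj[of g] by (intro neg_eqI[symmetric]) auto
qed

text \<open>With \<open>u\<close> written as 1 + n, where n has square zero, the truncated geometric
  series 1 - n is a two-sided inverse.\<close>

lemma isomorphism_if_diff_square_zero:
  assumes u: "u \<in> Hom C A A"
    and n: "(u \<oplus> Neg C (Id C A)) \<cdot> (u \<oplus> Neg C (Id C A)) = ZeroM C A A"
  shows "isomorphism C A A u"
proof -
  define n where "n = u \<oplus> Neg C (Id C A)"
  have A [simp]: "A \<in> Obj C" using Hom_obj[OF u] by simp
  have n_hom [simp]: "n \<in> Mor C" "Dom C n = A" "Cod C n = A"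
    using u by (simp_all add: n_def Hom_iff)
  have nn [simp]: "n \<cdot> n = ZeroM C A A" using n by (simp add: n_def)
  have u_eq: "u = n \<oplus> Id C A" using u by (simp add: n_def Hom_iff add_assoc_mor)
  define v where "v = Neg C n \<oplus> Id C A"
  have v_hom: "v \<in> Hom C A A" by (simp add: v_def Hom_iff)
  have "v \<cdot> u = Id C A"
    by (simp add: u_eq v_def comp_add_mor comp_neg add_assoc_mor add_neg_cancel_left)
  moreover have "u \<cdot> v = Id C A"
    by (simp add: u_eq v_def comp_add_mor comp_neg add_assoc_mor add_neg_cancel_left)
  ultimately show ?thesis using u v_hom by (auto simp: isomorphism_def)
qed

text \<open>A morphism from or to \<open>Z\<close> equals its composite with \<open>Id C Z\<close>,
  hence is zero once the identity is. The equation mentions no other object, so it can be carried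
  between a category and a full subcategory.\<close>

lemma zero_object_iff_id:
  "zero_object C Z \<longleftrightarrow> Z \<in> Obj C \<and> Id C Z = ZeroM C Z Z"
proof
  assume Z: "zero_object C Z"
  then show "Z \<in> Obj C \<and> Id C Z = ZeroM C Z Z"
    unfolding zero_object_def by (metis Hom_iff id_hom zero_mor)
next
  assume Z: "Z \<in> Obj C \<and> Id C Z = ZeroM C Z Z"
  have "f = ZeroM C Z A" if "f \<in> Hom C Z A" for A f
  proof -
    have "f = f \<cdot> Id C Z" using that by (simp add: Hom_iff)
    also have "\<dots> = ZeroM C Z A" using that Z by (simp add: Hom_iff)
    finally show ?thesis .
  qed
  moreover have "f = ZeroM C A Z" if "f \<in> Hom C A Z" for A f
  proof -
    have "f = Id C Z \<cdot> f" using that by (simp add: Hom_iff)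
    also have "\<dots> = ZeroM C A Z" using that Z by (simp add: Hom_iff)
    finally show ?thesis .
  qed
  moreover have "ZeroM C Z A \<in> Hom C Z A" "ZeroM C A Z \<in> Hom C A Z" if "A \<in> Obj C" for A
    using that Z by (simp_all add: Hom_iff)
  ultimately show "zero_object C Z"
    unfolding zero_object_def using Z by metis
qed

subsection \<open>Full additive subcategories\<close>

lemma Hom_full_subcategory:
  "Hom (full_subcategory C X) A B = (if A \<in> X \<and> B \<in> X then Hom C A B else {})"
  by (auto simp: Hom_def full_subcategory_def)

lemma full_subcategory_simps [simp]:
  "Obj (full_subcategory C X) = X" "Id (full_subcategory C X) = Id C"
  "Comp (full_subcategory C X) = Comp C" "Add (full_subcategory C X) = Add C"
  "ZeroM (full_subcategory C X) = ZeroM C"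
  by (simp_all add: full_subcategory_def)

lemma biproduct_full_subcategory:
  assumes "A \<in> X" "B \<in> X" "S \<in> X"
  shows "biproduct (full_subcategory C X) A B S i j p q \<longleftrightarrow> biproduct C A B S i j p q"
  using assms by (simp add: biproduct_def Hom_full_subcategory)

text \<open>Hom groups, composition and identities are inherited from \<open>C\<close>, and for
  objects of \<open>X\<close> the equations characterising zero objects and biproducts read the same
  in both categories.\<close>

lemma full_additive_subcategory_iff:
  "full_additive_subcategory C X \<longleftrightarrow> X \<subseteq> Obj C \<and> (\<exists>Z\<in>X. zero_object C Z) \<and>
    (\<forall>A\<in>X. \<forall>B\<in>X. \<exists>S\<in>X. \<exists>i j p q. biproduct C A B S i j p q)"
proof
  assume F: "full_additive_subcategory C X"
  then have X: "X \<subseteq> Obj C" by (simp add: full_additive_subcategory_def)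
  interpret F: additive_category "full_subcategory C X"
    using F by (simp add: full_additive_subcategory_def)
  obtain Z where "zero_object (full_subcategory C X) Z" using F.ex_zero_object by blast
  then have "Z \<in> X \<and> zero_object C Z"
    using X by (auto simp: F.zero_object_iff_id zero_object_iff_id)
  moreover have "\<exists>S\<in>X. \<exists>i j p q. biproduct C A B S i j p q" if "A \<in> X" "B \<in> X" for A B
    using F.ex_biproduct[of A B] that by (auto simp: biproduct_full_subcategory)
  ultimately show "X \<subseteq> Obj C \<and> (\<exists>Z\<in>X. zero_object C Z) \<and>
      (\<forall>A\<in>X. \<forall>B\<in>X. \<exists>S\<in>X. \<exists>i j p q. biproduct C A B S i j p q)"
    using X by blast
next
  assume R: "X \<subseteq> Obj C \<and> (\<exists>Z\<in>X. zero_object C Z) \<and>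
    (\<forall>A\<in>X. \<forall>B\<in>X. \<exists>S\<in>X. \<exists>i j p q. biproduct C A B S i j p q)"
  then have X: "X \<subseteq> Obj C" and sub: "\<And>A. A \<in> X \<Longrightarrow> A \<in> Obj C" by auto
  have "additive_category (full_subcategory C X)"
  proof (intro additive_category.intro category.intro additive_category_axioms.intro)
    show "Dom (full_subcategory C X) f \<in> Obj (full_subcategory C X)"
      "Cod (full_subcategory C X) f \<in> Obj (full_subcategory C X)"
      if "f \<in> Mor (full_subcategory C X)" for f
      using that by (simp_all add: full_subcategory_def)
    show "comm_group (hom_group (full_subcategory C X) A B)"
      if "A \<in> Obj (full_subcategory C X)" "B \<in> Obj (full_subcategory C X)" for A B
      using that hom_comm_group[of A B] sub by (simp add: hom_group_def Hom_full_subcategory)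
    obtain Z where "Z \<in> X" "zero_object C Z" using R by blast
    then have "zero_object (full_subcategory C X) Z"
      using sub by (auto simp: zero_object_def Hom_full_subcategory)
    then show "\<exists>Z. zero_object (full_subcategory C X) Z" ..
    show "\<exists>S\<in>Obj (full_subcategory C X). \<exists>i j p q. biproduct (full_subcategory C X) A B S i j p q"
      if "A \<in> Obj (full_subcategory C X)" "B \<in> Obj (full_subcategory C X)" for A B
      using that R by (simp add: biproduct_full_subcategory cong: bex_cong)
  qed (auto simp: Hom_full_subcategory id_hom sub comp_hom comp_id_right comp_id_left comp_assoc
      comp_add_right comp_add_left split: if_splits)
  then show "full_additive_subcategory C X" using X by (simp add: full_additive_subcategory_def)
qed

end

section \<open>Triangulated categories\<close>

context triangulated_category
begin

section \<open>The translation functor\<close>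

lemma shift_hom: "f \<in> Hom C A B \<Longrightarrow> ShM C f \<in> Hom C (ShO C A) (ShO C B)"
  using shift_fully_faithful[of A B] Hom_obj[of f A B] by (auto dest: bij_betwE)

lemma shift_mor [simp]:
  assumes "f \<in> Mor C"
  shows "ShM C f \<in> Mor C" "Dom C (ShM C f) = ShO C (Dom C f)" "Cod C (ShM C f) = ShO C (Cod C f)"
  using shift_hom[of f "Dom C f" "Cod C f"] assms by (simp_all add: Hom_iff)

declare shift_obj [simp]

lemma shift_inj: "f \<in> Hom C A B \<Longrightarrow> g \<in> Hom C A B \<Longrightarrow> ShM C f = ShM C g \<Longrightarrow> f = g"
  using shift_fully_faithful[of A B] Hom_obj[of f A B] by (auto simp: bij_betw_def dest: inj_onD)

lemma shift_surj:
  assumes "A \<in> Obj C" "B \<in> Obj C" "g \<in> Hom C (ShO C A) (ShO C B)"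
  obtains f where "f \<in> Hom C A B" "ShM C f = g"
  using shift_fully_faithful[OF assms(1,2)] assms(3) by (metis bij_betw_imp_surj_on imageE)

lemma shift_comp_mor:
  "f \<in> Mor C \<Longrightarrow> g \<in> Mor C \<Longrightarrow> Dom C g = Cod C f \<Longrightarrow> ShM C (g \<cdot> f) = ShM C g \<cdot> ShM C f"
  by (rule shift_comp) (auto simp: Hom_iff)

lemma shift_zero [simp]:
  assumes "A \<in> Obj C" "B \<in> Obj C"
  shows "ShM C (ZeroM C A B) = ZeroM C (ShO C A) (ShO C B)"
proof -
  have "ShM C (ZeroM C A B) \<oplus> ShM C (ZeroM C A B) = ShM C (ZeroM C A B)"
    using shift_add[of "ZeroM C A B" A B "ZeroM C A B"] assms by (simp add: Hom_iff)
  from zero_if_idempotent[OF _ this] show ?thesis using assms by simp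
qed

section \<open>Rotating, completing and filling triangles\<close>

lemma distinguishedD:
  assumes "distinguished C A B D f g h"
  shows "f \<in> Hom C A B" "g \<in> Hom C B D" "h \<in> Hom C D (ShO C A)"
    "A \<in> Obj C" "B \<in> Obj C" "D \<in> Obj C"
  using assms Hom_obj[of f A B] Hom_obj[of g B D] by (auto simp: distinguished_def triangle_def)

lemma rotate:
  "distinguished C A B D f g h \<Longrightarrow> distinguished C B D (ShO C A) g h (Neg C (ShM C f))"
  using TR2 by (auto simp: distinguished_def)

lemma rotate_back:
  assumes "distinguished C B D (ShO C A) g h (Neg C (ShM C f))" "f \<in> Hom C A B"
  shows "distinguished C A B D f g h"
  using TR2[of A B D f g h] assms distinguishedD[OF assms(1)] by (simp add: triangle_def)

text \<open>To rotate the cone triangle of \<open>g\<close> back, its third object must be a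
  translate. As the translation is only essentially surjective, the cone \<open>E\<close> is first
  replaced by an isomorphic \<open>ShO C A\<close>.\<close>

lemma ex_distinguished_second:
  assumes g: "g \<in> Hom C B D"
  obtains A f h where "distinguished C A B D f g h"
proof -
  obtain E u v where T: "distinguished C B D E g u v" using TR1_cone[OF g] by blast
  note T_hom = distinguishedD[OF T]
  obtain A s where A: "A \<in> Obj C" and s: "isomorphism C (ShO C A) E s"
    using shift_ess_surj[of E] T_hom by blast
  obtain t where t: "isomorphism C E (ShO C A) t" "s \<cdot> t = Id C E"
    using isomorphism_sym[OF s] by blast
  have st_hom: "s \<in> Hom C (ShO C A) E" "t \<in> Hom C E (ShO C A)"
    using s t by (auto simp: isomorphism_def)
  \<comment> \<open>The sign is chosen to cancel the negation in the rotation axiom.\<close>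
  have "Neg C (v \<cdot> s) \<in> Hom C (ShO C A) (ShO C B)" using st_hom T_hom by (simp add: Hom_iff)
  then obtain f where f: "f \<in> Hom C A B" "ShM C f = Neg C (v \<cdot> s)"
    using shift_surj[of A B] A T_hom by blast
  have neg_f: "Neg C (ShM C f) = v \<cdot> s" using f st_hom T_hom by (simp add: Hom_iff)
  have "distinguished C B D (ShO C A) g (t \<cdot> u) (Neg C (ShM C f))"
    using TR1_iso[OF T _ isomorphism_id isomorphism_id t(1), of g "t \<cdot> u" "v \<cdot> s"]
      T_hom st_hom t(2)
    by (simp add: neg_f triangle_def Hom_iff comp_assoc_mor shift_id)
  then show thesis using that rotate_back f by blast
qed

text \<open>Completing \<open>w\<close> on the left gives a triangle whose last morphism runs
  between translates; by fullness it is, up to sign, the translate of the missing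
  \<open>f\<close>.\<close>

lemma ex_distinguished_third:
  assumes w: "w \<in> Hom C B (ShO C A)" and A: "A \<in> Obj C"
  obtains Z f g where "distinguished C A Z B f g w"
proof -
  obtain Z g h where T: "distinguished C Z B (ShO C A) g w h"
    using ex_distinguished_second[OF w] by blast
  note T_hom = distinguishedD[OF T]
  have "Neg C h \<in> Hom C (ShO C A) (ShO C Z)" using T_hom by (simp add: Hom_iff)
  then obtain f where f: "f \<in> Hom C A Z" "ShM C f = Neg C h"
    using shift_surj[of A Z] A T_hom by blast
  then have "Neg C (ShM C f) = h" using T_hom by (simp add: Hom_iff)
  then show thesis using that rotate_back[of Z B A g w f] T f by simp
qed

text \<open>One rotation moves the missing first component to the third place, where
  \<open>TR3\<close> supplies it as a morphism between translates; full faithfulness brings it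
  back.\<close>

lemma fill_first:
  assumes T: "distinguished C A B D f g h" and T': "distinguished C A' B' D' f' g' h'"
    and b: "b \<in> Hom C B B'" and d: "d \<in> Hom C D D'" and eq: "d \<cdot> g = g' \<cdot> b"
  obtains a where "a \<in> Hom C A A'" "b \<cdot> f = f' \<cdot> a" "ShM C a \<cdot> h = h' \<cdot> d"
proof -
  note hom = distinguishedD[OF T] distinguishedD[OF T']
  obtain e where e: "e \<in> Hom C (ShO C A) (ShO C A')" "e \<cdot> h = h' \<cdot> d"
    "ShM C b \<cdot> Neg C (ShM C f) = Neg C (ShM C f') \<cdot> e"
    using TR3[OF rotate[OF T] rotate[OF T'] b d eq] by blast
  obtain a where a: "a \<in> Hom C A A'" "ShM C a = e"
    using shift_surj[OF _ _ e(1)] hom by blast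
  have "Neg C (ShM C (b \<cdot> f)) = Neg C (ShM C (f' \<cdot> a))"
    using e(3) a(1) b hom by (simp add: Hom_iff comp_neg shift_comp_mor flip: a(2))
  \<comment> \<open>Negating once more removes the sign introduced by the rotation.\<close>
  then have "Neg C (Neg C (ShM C (b \<cdot> f))) = Neg C (Neg C (ShM C (f' \<cdot> a)))" by simp
  then have "ShM C (b \<cdot> f) = ShM C (f' \<cdot> a)" using a b hom by (simp add: Hom_iff)
  then have "b \<cdot> f = f' \<cdot> a"
    using a b hom by (intro shift_inj[of "b \<cdot> f" A B']) (auto simp: Hom_iff)
  then show thesis using that a e by blast
qed

text \<open>After one rotation the missing component is the first one, so \<open>fill_first\<close>
  applies.\<close>

lemma fill_middle:
  assumes T: "distinguished C A B D f g h" and T': "distinguished C A' B' D' f' g' h'"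
    and a: "a \<in> Hom C A A'" and d: "d \<in> Hom C D D'" and eq: "ShM C a \<cdot> h = h' \<cdot> d"
  obtains b where "b \<in> Hom C B B'" "b \<cdot> f = f' \<cdot> a" "d \<cdot> g = g' \<cdot> b"
proof -
  note hom = distinguishedD[OF T] distinguishedD[OF T']
  obtain b where b: "b \<in> Hom C B B'" "d \<cdot> g = g' \<cdot> b"
    "ShM C b \<cdot> Neg C (ShM C f) = Neg C (ShM C f') \<cdot> ShM C a"
    using fill_first[OF rotate[OF T] rotate[OF T'] d shift_hom[OF a] eq] by blast
  have "Neg C (ShM C (b \<cdot> f)) = Neg C (ShM C (f' \<cdot> a))"
    using b a hom by (simp add: Hom_iff comp_neg shift_comp_mor)
  then have "Neg C (Neg C (ShM C (b \<cdot> f))) = Neg C (Neg C (ShM C (f' \<cdot> a)))" by simp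
  then have "ShM C (b \<cdot> f) = ShM C (f' \<cdot> a)" using a b hom by (simp add: Hom_iff)
  then have "b \<cdot> f = f' \<cdot> a"
    using a b hom by (intro shift_inj[of "b \<cdot> f" A B']) (auto simp: Hom_iff)
  then show thesis using that b by blast
qed

text \<open>The pair (\<open>Id C A\<close>, \<open>f\<close>) starts a morphism from the triangle
  on \<open>Id C A\<close>, whose third object is zero, so \<open>g \<cdot> f\<close> factors
  through a zero object. The second relation is the first one for the rotated triangle.\<close>

lemma distinguished_comp_zero:
  assumes T: "distinguished C A B D f g h"
  shows "g \<cdot> f = ZeroM C A D" "h \<cdot> g = ZeroM C B (ShO C A)"
proof -
  have comp_zero': "g \<cdot> f = ZeroM C A D" if T: "distinguished C A B D f g h" for A B D f g h
  proof -
    note hom = distinguishedD[OF T]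
    obtain Z where Z: "zero_object C Z" using ex_zero_object by blast
    then have "Z \<in> Obj C" by (simp add: zero_object_def)
    moreover obtain d where "d \<in> Hom C Z D" "d \<cdot> ZeroM C A Z = g \<cdot> f"
      using TR3[OF TR1_id[OF hom(4) Z] T id_hom[OF hom(4)] hom(1)] by blast
    ultimately show ?thesis using hom by (simp add: Hom_iff)
  qed
  show "g \<cdot> f = ZeroM C A D" "h \<cdot> g = ZeroM C B (ShO C A)"
    using comp_zero'[OF T] comp_zero'[OF rotate[OF T]] .
qed

text \<open>This makes \<open>g\<close> a weak cokernel of \<open>f\<close>. In a morphism to a
  triangle whose second morphism is \<open>Id C T\<close>, with components zero and
  \<open>c\<close>, the third component is the factor.\<close>

lemma factor_through_second:
  assumes T: "distinguished C A B D f g h" and c: "c \<in> Hom C B T" "c \<cdot> f = ZeroM C A T"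
  obtains e where "e \<in> Hom C D T" "c = e \<cdot> g"
proof -
  note hom = distinguishedD[OF T]
  have T_obj: "T \<in> Obj C" using Hom_obj[OF c(1)] by simp
  obtain K k l where K: "distinguished C K T T k (Id C T) l"
    using ex_distinguished_second[OF id_hom[OF T_obj]] by blast
  note K_hom = distinguishedD[OF K]
  have "ZeroM C A K \<in> Hom C A K" "c \<cdot> f = k \<cdot> ZeroM C A K"
    using c hom K_hom by (simp_all add: Hom_iff)
  then obtain e where "e \<in> Hom C D T" "e \<cdot> g = Id C T \<cdot> c"
    using TR3[OF T K _ c(1)] by blast
  then show thesis using that c by (simp add: Hom_iff)
qed

text \<open>The composite \<open>ShM C b \<cdot> h\<close> is the obstruction to extending
  \<open>b\<close> along \<open>f\<close>. When it vanishes, \<open>b\<close> and a zero morphism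
  are the outer components of a morphism to the triangle on \<open>Id C T\<close>, and its middle
  component is the extension.\<close>

lemma factor_through_first:
  assumes T: "distinguished C A B D f g h"
    and b: "b \<in> Hom C A T" "ShM C b \<cdot> h = ZeroM C D (ShO C T)"
  obtains c where "c \<in> Hom C B T" "b = c \<cdot> f"
proof -
  note hom = distinguishedD[OF T]
  have T_obj: "T \<in> Obj C" using Hom_obj[OF b(1)] by simp
  obtain Z where Z: "zero_object C Z" using ex_zero_object by blast
  then have Z_obj: "Z \<in> Obj C" by (simp add: zero_object_def)
  have "ZeroM C D Z \<in> Hom C D Z" "ShM C b \<cdot> h = ZeroM C Z (ShO C T) \<cdot> ZeroM C D Z"
    using b Z_obj T_obj hom by (simp_all add: Hom_iff)
  then obtain c where "c \<in> Hom C B T" "c \<cdot> f = Id C T \<cdot> b"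
    using fill_middle[OF T TR1_id[OF T_obj Z] b(1)] by blast
  then show thesis using that b by (simp add: Hom_iff)
qed

subsection \<open>Approximations by extensions\<close>

lemma extension_left_approximation:
  assumes y: "left_approximation C Y M V y" and T: "distinguished C K M V k y h"
    and x: "left_approximation C X K U x" and U: "U \<in> Obj C"
  obtains Z m where "left_approximation C (extension C X Y) M Z m"
proof -
  note hom = distinguishedD[OF T]
  have x_hom: "x \<in> Hom C K U" using x by (simp add: left_approximation_def)
  have "ShM C x \<cdot> h \<in> Hom C V (ShO C U)" using x_hom hom by (simp add: Hom_iff)
  then obtain Z z \<pi> where Z: "distinguished C U Z V z \<pi> (ShM C x \<cdot> h)"
    using ex_distinguished_third U by blast
  note Z_hom = distinguishedD[OF Z]
  \<comment> \<open>This is the compatibility needed for (\<open>x\<close>, \<open>Id C V\<close>)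
    to have a middle filler.\<close>
  have "ShM C x \<cdot> h = (ShM C x \<cdot> h) \<cdot> Id C V" using x_hom hom by (simp add: Hom_iff)
  then obtain m where m: "m \<in> Hom C M Z" "m \<cdot> k = z \<cdot> x" "Id C V \<cdot> y = \<pi> \<cdot> m"
    using fill_middle[OF T Z x_hom id_hom[OF hom(6)]] by blast
  have m_y: "\<pi> \<cdot> m = y" using m hom by (simp add: Hom_iff)
  have "Z \<in> extension C X Y"
    using Z Z_hom(5) x y unfolding extension_def left_approximation_def by blast
  moreover have "\<exists>g\<in>Hom C Z W. f = g \<cdot> m"
    if W: "W \<in> extension C X Y" and f: "f \<in> Hom C M W" for W f
  proof -
    obtain U' V' f' g' h' where U': "U' \<in> X" and V': "V' \<in> Y"
      and T': "distinguished C U' W V' f' g' h'"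
      using W by (auto simp: extension_def)
    note T'_hom = distinguishedD[OF T']
    have "g' \<cdot> f \<in> Hom C M V'" using f T'_hom by (simp add: Hom_iff)
    then obtain d where d: "d \<in> Hom C V V'" "d \<cdot> y = g' \<cdot> f"
      using y V' unfolding left_approximation_def by metis
    obtain a where a: "a \<in> Hom C K U'" "f \<cdot> k = f' \<cdot> a"
      using fill_first[OF T T' f d] by blast
    obtain b where b: "b \<in> Hom C U U'" "a = b \<cdot> x"
      using x U' a(1) unfolding left_approximation_def by blast
    \<comment> \<open>The morphisms \<open>f' \<cdot> b\<close> on \<open>U\<close> and
      \<open>f\<close> on \<open>M\<close> agree on \<open>K\<close>, as the weak pushout property
      requires.\<close>
    have fk: "(f' \<cdot> b) \<cdot> x = f \<cdot> k"
      using a b T'_hom x_hom by (simp add: Hom_iff comp_assoc_mor)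
    have kh: "ShM C k \<cdot> h = ZeroM C V (ShO C M)"
    proof -
      have "Neg C (ShM C k) \<cdot> h = ZeroM C V (ShO C M)"
        using distinguished_comp_zero(2)[OF rotate[OF T]] .
      then have "Neg C (ShM C k \<cdot> h) = ZeroM C V (ShO C M)" using hom by (simp add: Hom_iff comp_neg)
      then have "ShM C k \<cdot> h = Neg C (ZeroM C V (ShO C M))"
        using hom neg_neg[of "ShM C k \<cdot> h"] by (simp add: Hom_iff)
      then show ?thesis using hom by simp
    qed
    \<comment> \<open>This composite is the obstruction to extending \<open>f' \<cdot> b\<close>
      along \<open>z\<close>. It vanishes because the agreement on \<open>K\<close> lets
      \<open>ShM C k \<cdot> h\<close> split off.\<close>
    have "ShM C (f' \<cdot> b) \<cdot> (ShM C x \<cdot> h) = ShM C ((f' \<cdot> b) \<cdot> x) \<cdot> h"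
      using b T'_hom x_hom hom by (simp add: Hom_iff comp_assoc_mor shift_comp_mor)
    also have "\<dots> = ShM C f \<cdot> (ShM C k \<cdot> h)"
      using fk f hom by (simp add: Hom_iff comp_assoc_mor shift_comp_mor)
    also have "\<dots> = ZeroM C V (ShO C W)" using kh f hom T'_hom by (simp add: Hom_iff)
    finally obtain c where c: "c \<in> Hom C Z W" "f' \<cdot> b = c \<cdot> z"
      using factor_through_first[OF Z comp_hom[OF b(1) T'_hom(1)]] by blast
    \<comment> \<open>\<open>c m\<close> need not equal \<open>f\<close>, but the error \<open>n\<close> factors through \<open>y = \<pi> m\<close>, so \<open>c\<close> can be
      corrected by a multiple of \<open>\<pi>\<close>.\<close>
    define n where "n = (c \<cdot> m) \<oplus> Neg C f"
    have n_hom: "n \<in> Hom C M W" using c m f by (simp add: n_def Hom_iff)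
    have "(c \<cdot> m) \<cdot> k = f \<cdot> k"
    proof -
      have "(c \<cdot> m) \<cdot> k = (c \<cdot> z) \<cdot> x"
        using c(1) m(1,2) hom Z_hom x_hom by (simp add: Hom_iff comp_assoc_mor)
      then show ?thesis using fk c(2) by simp
    qed
    then have "n \<cdot> k = ZeroM C K W"
      using c(1) m(1) f hom by (simp add: n_def Hom_iff comp_add_mor comp_neg)
    then obtain e where e: "e \<in> Hom C V W" "n = e \<cdot> y"
      using factor_through_second[OF T n_hom] by blast
    have ne: "(e \<cdot> \<pi>) \<cdot> m = n" using e m_y m(1) Z_hom by (simp add: Hom_iff comp_assoc_mor)
    have "(c \<oplus> Neg C (e \<cdot> \<pi>)) \<cdot> m = (c \<cdot> m) \<oplus> Neg C n"
      using c(1) e(1) m(1) Z_hom ne by (simp add: Hom_iff comp_add_mor comp_neg)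
    also have "\<dots> = f"
    proof -
      have "n \<oplus> f = c \<cdot> m" using c(1) m(1) f by (simp add: n_def Hom_iff add_assoc_mor)
      then have "(c \<cdot> m) \<oplus> Neg C n = (f \<oplus> n) \<oplus> Neg C n"
        using n_hom f by (simp add: add_commute_mor Hom_iff)
      then show ?thesis using n_hom f by (simp add: add_assoc_mor Hom_iff)
    qed
    finally show ?thesis
      using c(1) e(1) Z_hom by (intro bexI[of _ "c \<oplus> Neg C (e \<cdot> \<pi>)"]) (auto simp: Hom_iff)
  qed
  ultimately have "left_approximation C (extension C X Y) M Z m"
    using m(1) by (simp add: left_approximation_def)
  then show thesis by (rule that)
qed

subsection \<open>Direct sums of triangles\<close>

text \<open>The difference n of \<open>u\<close> and the identity kills \<open>f\<close>, so it
  factors as \<open>e \<cdot> g\<close>; since \<open>g\<close> kills n, its square is zero. The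
  weak cokernel property is a hypothesis of its own so that the lemma also covers a direct sum not
  yet known to be distinguished.\<close>

lemma isomorphism_if_fixes_ends:
  assumes u: "u \<in> Hom C B B" and f: "f \<in> Hom C A B" and g: "g \<in> Hom C B D"
    and factor: "\<And>c. c \<in> Hom C B B \<Longrightarrow> c \<cdot> f = ZeroM C A B \<Longrightarrow> \<exists>e\<in>Hom C D B. c = e \<cdot> g"
    and uf: "u \<cdot> f = f" and gu: "g \<cdot> u = g"
  shows "isomorphism C B B u"
proof -
  define n where "n = u \<oplus> Neg C (Id C B)"
  have B: "B \<in> Obj C" using Hom_obj[OF u] by simp
  have n_hom: "n \<in> Hom C B B" using u B by (simp add: n_def Hom_iff)
  have nf: "n \<cdot> f = ZeroM C A B" and gn: "g \<cdot> n = ZeroM C B D"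
    using u f g B uf gu by (simp_all add: n_def Hom_iff comp_add_mor comp_neg)
  obtain e where e: "e \<in> Hom C D B" "n = e \<cdot> g" using factor[OF n_hom nf] by blast
  have "n \<cdot> n = e \<cdot> (g \<cdot> n)" using e n_hom g by (simp add: Hom_iff flip: comp_assoc_mor)
  also have "\<dots> = ZeroM C B B" using gn e(1) B by (simp add: Hom_iff)
  finally show ?thesis using isomorphism_if_diff_square_zero[OF u] by (simp add: n_def)
qed

text \<open>Only the existence of some triangle on the given sums is recorded, which is what
  membership in \<open>extension\<close> asks for.\<close>

lemma distinguished_biproduct:
  assumes T1: "distinguished C A1 B1 D1 f1 g1 h1" and T2: "distinguished C A2 B2 D2 f2 g2 h2"
    and bA: "biproduct C A1 A2 A iA jA pA qA" and bB: "biproduct C B1 B2 B iB jB pB qB"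
    and bD: "biproduct C D1 D2 D iD jD pD qD"
  obtains f g h where "distinguished C A B D f g h"
proof -
  note hom = distinguishedD[OF T1] distinguishedD[OF T2]
  have A_hom: "iA \<in> Hom C A1 A" "jA \<in> Hom C A2 A" "pA \<in> Hom C A A1" "qA \<in> Hom C A A2"
    and A_eq: "pA \<cdot> iA = Id C A1" "qA \<cdot> jA = Id C A2" "pA \<cdot> jA = ZeroM C A2 A1"
      "qA \<cdot> iA = ZeroM C A1 A2" "(iA \<cdot> pA) \<oplus> (jA \<cdot> qA) = Id C A"
    using bA by (auto simp: biproduct_def)
  have B_hom: "iB \<in> Hom C B1 B" "jB \<in> Hom C B2 B" "pB \<in> Hom C B B1" "qB \<in> Hom C B B2"
    and B_eq: "pB \<cdot> iB = Id C B1" "qB \<cdot> jB = Id C B2" "pB \<cdot> jB = ZeroM C B2 B1"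
      "qB \<cdot> iB = ZeroM C B1 B2" "(iB \<cdot> pB) \<oplus> (jB \<cdot> qB) = Id C B"
    using bB by (auto simp: biproduct_def)
  have D_hom: "iD \<in> Hom C D1 D" "jD \<in> Hom C D2 D" "pD \<in> Hom C D D1" "qD \<in> Hom C D D2"
    and D_eq: "pD \<cdot> iD = Id C D1" "qD \<cdot> jD = Id C D2" "pD \<cdot> jD = ZeroM C D2 D1"
      "qD \<cdot> iD = ZeroM C D1 D2" "(iD \<cdot> pD) \<oplus> (jD \<cdot> qD) = Id C D"
    using bD by (auto simp: biproduct_def)
  note obj = Hom_obj[OF A_hom(1)] Hom_obj[OF B_hom(1)] Hom_obj[OF D_hom(1)]
  note homs = hom[unfolded Hom_iff] A_hom[unfolded Hom_iff] B_hom[unfolded Hom_iff]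
    D_hom[unfolded Hom_iff] obj
  have A_shift: "ShM C pA \<cdot> ShM C iA = Id C (ShO C A1)" "ShM C qA \<cdot> ShM C jA = Id C (ShO C A2)"
    "ShM C pA \<cdot> ShM C jA = ZeroM C (ShO C A2) (ShO C A1)"
    "ShM C qA \<cdot> ShM C iA = ZeroM C (ShO C A1) (ShO C A2)"
    using A_eq homs by (simp_all add: shift_id flip: shift_comp_mor)
  note A_red = A_eq A_eq(1)[THEN comp_reduce, OF A_hom(1,3)] A_eq(2)[THEN comp_reduce, OF A_hom(2,4)]
    A_eq(3)[THEN comp_reduce, OF A_hom(2,3)] A_eq(4)[THEN comp_reduce, OF A_hom(1,4)]
  note As_red = A_shift A_shift(1)[THEN comp_reduce, OF A_hom(1,3)[THEN shift_hom]]
    A_shift(2)[THEN comp_reduce, OF A_hom(2,4)[THEN shift_hom]]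
    A_shift(3)[THEN comp_reduce, OF A_hom(2,3)[THEN shift_hom]]
    A_shift(4)[THEN comp_reduce, OF A_hom(1,4)[THEN shift_hom]]
  note B_red = B_eq B_eq(1)[THEN comp_reduce, OF B_hom(1,3)] B_eq(2)[THEN comp_reduce, OF B_hom(2,4)]
    B_eq(3)[THEN comp_reduce, OF B_hom(2,3)] B_eq(4)[THEN comp_reduce, OF B_hom(1,4)]
  note D_red = D_eq D_eq(1)[THEN comp_reduce, OF D_hom(1,3)] D_eq(2)[THEN comp_reduce, OF D_hom(2,4)]
    D_eq(3)[THEN comp_reduce, OF D_hom(2,3)] D_eq(4)[THEN comp_reduce, OF D_hom(1,4)]
  \<comment> \<open>The direct sum of \<open>h1\<close> and \<open>h2\<close>, written with the
    translated injections of \<open>A\<close>.\<close>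
  define w where "w = (ShM C iA \<cdot> (h1 \<cdot> pD)) \<oplus> (ShM C jA \<cdot> (h2 \<cdot> qD))"
  have "w \<in> Hom C D (ShO C A)" using homs by (simp add: w_def Hom_iff)
  then obtain E f g where E: "distinguished C A E D f g w"
    using ex_distinguished_third obj by blast
  note E_hom = distinguishedD[OF E]
  have "ShM C pA \<cdot> w = h1 \<cdot> pD" "ShM C qA \<cdot> w = h2 \<cdot> qD"
    using homs As_red by (simp_all add: w_def comp_add_mor)
  then obtain p q where p: "p \<in> Hom C E B1" "p \<cdot> f = f1 \<cdot> pA" "pD \<cdot> g = g1 \<cdot> p"
    and q: "q \<in> Hom C E B2" "q \<cdot> f = f2 \<cdot> qA" "qD \<cdot> g = g2 \<cdot> q"
    using fill_middle[OF E T1 A_hom(3) D_hom(3)] fill_middle[OF E T2 A_hom(4) D_hom(4)] by metis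
  have "ShM C iA \<cdot> h1 = w \<cdot> iD" "ShM C jA \<cdot> h2 = w \<cdot> jD"
    using homs D_red by (simp_all add: w_def comp_add_mor comp_assoc_mor)
  then obtain i j where i: "i \<in> Hom C B1 E" "i \<cdot> f1 = f \<cdot> iA" "iD \<cdot> g1 = g \<cdot> i"
    and j: "j \<in> Hom C B2 E" "j \<cdot> f2 = f \<cdot> jA" "jD \<cdot> g2 = g \<cdot> j"
    using fill_middle[OF T1 E A_hom(1) D_hom(1)] fill_middle[OF T2 E A_hom(2) D_hom(2)] by metis
  note homs' = homs E_hom[unfolded Hom_iff] p(1)[unfolded Hom_iff] q(1)[unfolded Hom_iff]
    i(1)[unfolded Hom_iff] j(1)[unfolded Hom_iff]
  \<comment> \<open>The fillers are not unique and were chosen independently, so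
    \<open>\<phi>\<close> and \<open>\<psi>\<close> need not be mutually inverse.\<close>
  define \<phi> where "\<phi> = (iB \<cdot> p) \<oplus> (jB \<cdot> q)"
  define \<psi> where "\<psi> = (i \<cdot> pB) \<oplus> (j \<cdot> qB)"
  have \<phi>_hom: "\<phi> \<in> Hom C E B" and \<psi>_hom: "\<psi> \<in> Hom C B E"
    using homs' by (simp_all add: \<phi>_def \<psi>_def Hom_iff)
  define f' where "f' = (iB \<cdot> (f1 \<cdot> pA)) \<oplus> (jB \<cdot> (f2 \<cdot> qA))"
  define g' where "g' = (iD \<cdot> (g1 \<cdot> pB)) \<oplus> (jD \<cdot> (g2 \<cdot> qB))"
  have f'_hom: "f' \<in> Hom C A B" and g'_hom: "g' \<in> Hom C B D"
    using homs' by (simp_all add: f'_def g'_def Hom_iff)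
  note maps = \<phi>_hom[unfolded Hom_iff] \<psi>_hom[unfolded Hom_iff] f'_hom[unfolded Hom_iff]
    g'_hom[unfolded Hom_iff]
  have \<phi>f: "\<phi> \<cdot> f = f'"
    using homs' p(2) q(2) by (simp add: \<phi>_def f'_def comp_add_mor comp_assoc_mor)
  have g\<psi>: "g \<cdot> \<psi> = g'"
  proof -
    have "g \<cdot> \<psi> = ((g \<cdot> i) \<cdot> pB) \<oplus> ((g \<cdot> j) \<cdot> qB)"
      using homs' by (simp add: \<psi>_def comp_add_mor comp_assoc_mor)
    then show ?thesis using homs' by (simp add: g'_def comp_assoc_mor flip: i(3) j(3))
  qed
  have \<psi>f': "\<psi> \<cdot> f' = f"
  proof -
    have "\<psi> \<cdot> f' = ((i \<cdot> f1) \<cdot> pA) \<oplus> ((j \<cdot> f2) \<cdot> qA)"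
      using homs' B_red by (simp add: \<psi>_def f'_def comp_add_mor comp_assoc_mor)
    also have "\<dots> = f \<cdot> ((iA \<cdot> pA) \<oplus> (jA \<cdot> qA))"
      using homs' by (simp add: i(2) j(2) comp_add_mor comp_assoc_mor)
    finally show ?thesis using homs' by (simp add: A_eq)
  qed
  have g'\<phi>: "g' \<cdot> \<phi> = g"
  proof -
    have "g' \<cdot> \<phi> = (iD \<cdot> (g1 \<cdot> p)) \<oplus> (jD \<cdot> (g2 \<cdot> q))"
      using homs' B_red by (simp add: \<phi>_def g'_def comp_add_mor comp_assoc_mor)
    also have "\<dots> = ((iD \<cdot> pD) \<oplus> (jD \<cdot> qD)) \<cdot> g"
      using homs' by (simp add: comp_add_mor comp_assoc_mor flip: p(3) q(3))
    finally show ?thesis using homs' by (simp add: D_eq)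
  qed
  have "isomorphism C E E (\<psi> \<cdot> \<phi>)"
  proof (rule isomorphism_if_fixes_ends[OF comp_hom[OF \<phi>_hom \<psi>_hom] E_hom(1,2)])
    show "\<exists>e\<in>Hom C D E. c = e \<cdot> g" if "c \<in> Hom C E E" "c \<cdot> f = ZeroM C A E" for c
      using factor_through_second[OF E that] by blast
    show "(\<psi> \<cdot> \<phi>) \<cdot> f = f" using homs' maps by (simp add: comp_assoc_mor \<phi>f \<psi>f')
    have "g \<cdot> (\<psi> \<cdot> \<phi>) = (g \<cdot> \<psi>) \<cdot> \<phi>" using homs' maps by (simp add: comp_assoc_mor)
    then show "g \<cdot> (\<psi> \<cdot> \<phi>) = g" by (simp add: g\<psi> g'\<phi>)
  qed
  moreover have "isomorphism C B B (\<phi> \<cdot> \<psi>)"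
  proof (rule isomorphism_if_fixes_ends[OF comp_hom[OF \<psi>_hom \<phi>_hom] f'_hom g'_hom])
    \<comment> \<open>The sum of the two triangles is not yet known to be distinguished, so
      \<open>c\<close> is restricted to both summands and factored through \<open>g1\<close> and
      \<open>g2\<close> separately.\<close>
    show "\<exists>e\<in>Hom C D B. c = e \<cdot> g'" if c: "c \<in> Hom C B B" "c \<cdot> f' = ZeroM C A B" for c
    proof -
      have c_mor: "c \<in> Mor C" "Dom C c = B" "Cod C c = B" using c by (simp_all add: Hom_iff)
      have f'_i: "f' \<cdot> iA = iB \<cdot> f1" "f' \<cdot> jA = jB \<cdot> f2"
        using homs A_red by (simp_all add: f'_def comp_add_mor comp_assoc_mor)
      have "(c \<cdot> iB) \<cdot> f1 = (c \<cdot> f') \<cdot> iA" "(c \<cdot> jB) \<cdot> f2 = (c \<cdot> f') \<cdot> jA"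
        using homs maps c_mor by (simp_all add: comp_assoc_mor f'_i)
      then have "(c \<cdot> iB) \<cdot> f1 = ZeroM C A1 B" "(c \<cdot> jB) \<cdot> f2 = ZeroM C A2 B"
        using homs c(2) by simp_all
      moreover have "c \<cdot> iB \<in> Hom C B1 B" "c \<cdot> jB \<in> Hom C B2 B"
        using homs c_mor by (simp_all add: Hom_iff)
      ultimately obtain e1 e2 where e1: "e1 \<in> Hom C D1 B" "c \<cdot> iB = e1 \<cdot> g1"
        and e2: "e2 \<in> Hom C D2 B" "c \<cdot> jB = e2 \<cdot> g2"
        using factor_through_second[OF T1] factor_through_second[OF T2] by metis
      note e_mor = e1(1)[unfolded Hom_iff] e2(1)[unfolded Hom_iff]
      have "((e1 \<cdot> pD) \<oplus> (e2 \<cdot> qD)) \<cdot> g' = ((e1 \<cdot> g1) \<cdot> pB) \<oplus> ((e2 \<cdot> g2) \<cdot> qB)"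
        using homs e_mor D_red by (simp add: g'_def comp_add_mor comp_assoc_mor)
      also have "\<dots> = c \<cdot> ((iB \<cdot> pB) \<oplus> (jB \<cdot> qB))"
        using homs c_mor by (simp add: comp_add_mor comp_assoc_mor flip: e1(2) e2(2))
      also have "\<dots> = c" using homs c_mor by (simp add: B_eq)
      finally show ?thesis
        using homs e_mor by (intro bexI[of _ "(e1 \<cdot> pD) \<oplus> (e2 \<cdot> qD)"]) (auto simp: Hom_iff)
    qed
    show "(\<phi> \<cdot> \<psi>) \<cdot> f' = f'" using homs' maps by (simp add: comp_assoc_mor \<phi>f \<psi>f')
    have "g' \<cdot> (\<phi> \<cdot> \<psi>) = (g' \<cdot> \<phi>) \<cdot> \<psi>" using homs' maps by (simp add: comp_assoc_mor)
    then show "g' \<cdot> (\<phi> \<cdot> \<psi>) = g'" by (simp add: g\<psi> g'\<phi>)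
  qed
  ultimately have "isomorphism C E B \<phi>"
    using isomorphism_of_inverses[OF \<phi>_hom \<psi>_hom _ \<psi>_hom] by blast
  \<comment> \<open>The triangle on \<open>E\<close> is transported along \<open>\<phi>\<close>,
    with identities on the outer terms.\<close>
  then have "distinguished C A B D f' g' w"
    using TR1_iso[OF E _ isomorphism_id _ isomorphism_id, of B f' g' w \<phi>] homs' maps
    by (simp add: triangle_def Hom_iff \<phi>f g'\<phi> shift_id)
  then show thesis by (rule that)
qed

text \<open>By \<open>full_additive_subcategory_iff\<close> only a zero object and binary sums are
  needed; a sum of extensions is an extension of the sums of the outer terms.\<close>

lemma full_additive_extension:
  assumes X: "full_additive_subcategory C X" and Y: "full_additive_subcategory C Y"
  shows "full_additive_subcategory C (extension C X Y)"
proof -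
  have "\<exists>Z\<in>extension C X Y. zero_object C Z"
  proof -
    obtain Z Z' where Z: "Z \<in> X" "zero_object C Z" and Z': "Z' \<in> Y" "zero_object C Z'"
      using X Y unfolding full_additive_subcategory_iff by blast
    then have "Z \<in> Obj C" by (simp add: zero_object_def)
    \<comment> \<open>The triangle on \<open>Id C Z\<close>, completed by the zero object
      \<open>Z'\<close> of \<open>Y\<close>, exhibits \<open>Z\<close> as an extension.\<close>
    then have "Z \<in> extension C X Y"
      unfolding extension_def using TR1_id[OF _ Z'(2)] Z(1) Z'(1) by blast
    then show ?thesis using Z(2) by blast
  qed
  moreover have "\<exists>S\<in>extension C X Y. \<exists>i j p q. biproduct C B1 B2 S i j p q"
    if B1: "B1 \<in> extension C X Y" and B2: "B2 \<in> extension C X Y" for B1 B2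
  proof -
    obtain A1 D1 f1 g1 h1 where 1: "A1 \<in> X" "D1 \<in> Y" "distinguished C A1 B1 D1 f1 g1 h1"
      using B1 unfolding extension_def by blast
    obtain A2 D2 f2 g2 h2 where 2: "A2 \<in> X" "D2 \<in> Y" "distinguished C A2 B2 D2 f2 g2 h2"
      using B2 unfolding extension_def by blast
    obtain A iA jA pA qA where A: "A \<in> X" "biproduct C A1 A2 A iA jA pA qA"
      using X 1 2 unfolding full_additive_subcategory_iff by blast
    obtain D iD jD pD qD where D: "D \<in> Y" "biproduct C D1 D2 D iD jD pD qD"
      using Y 1 2 unfolding full_additive_subcategory_iff by blast
    obtain B iB jB pB qB where B: "B \<in> Obj C" "biproduct C B1 B2 B iB jB pB qB"
      using ex_biproduct[of B1 B2] B1 B2 unfolding extension_def by blast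
    obtain f g h where "distinguished C A B D f g h"
      using distinguished_biproduct[OF 1(3) 2(3) A(2) B(2) D(2)] by blast
    then have "B \<in> extension C X Y" using A(1) B(1) D(1) unfolding extension_def by blast
    then show ?thesis using B(2) by blast
  qed
  ultimately show ?thesis by (auto simp: full_additive_subcategory_iff extension_def)
qed

end

theorem theorem1p4:
  fixes C :: "('o, 'm, 'z) triangulated_category_scheme"
    and X Y :: "'o set"
  assumes "triangulated_category C"
    and "covariantly_finite C X"
    and "covariantly_finite C Y"
  shows "covariantly_finite C (extension C X Y)"
proof -
  interpret triangulated_category C by (rule assms(1))
  have "\<exists>Z m. left_approximation C (extension C X Y) M Z m" if M: "M \<in> Obj C" for M
  proof -
    obtain V y where y: "left_approximation C Y M V y"
      using assms(3) M unfolding covariantly_finite_def by blast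
    then have "y \<in> Hom C M V" by (simp add: left_approximation_def)
    then obtain K k h where T: "distinguished C K M V k y h"
      using ex_distinguished_second by blast
    \<comment> \<open>The approximation in \<open>X\<close> is taken of the cocone \<open>K\<close>
      of \<open>y\<close>, not of \<open>M\<close>.\<close>
    obtain U x where x: "left_approximation C X K U x"
      using assms(2) distinguishedD(4)[OF T] unfolding covariantly_finite_def by blast
    then have "U \<in> Obj C" using Hom_obj[of x K U] by (simp add: left_approximation_def)
    then show ?thesis using extension_left_approximation[OF y T x] by blast
  qed
  then show ?thesis
    using assms(2,3) full_additive_extension by (simp add: covariantly_finite_def)
qed

end
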